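(* If two integer partitions $\mu$ and $\tau$ are rook equivalent, then they are Wilf equivalent, i.e. $|\mathcal{P}_n(\mu)|=|\mathcal{P}_n(\tau)|$ for every $n\ge 0$.
   Context: A partition is a weakly decreasing sequence $\mu=(\mu_1,\mu_2,\ldots)$ of nonnegative integers with finitely many positive terms; its weight is $|\mu|=\sum_i\mu_i$. A partition is identified with its Ferrers board (row $i$ has $\mu_i$ boxes, rows left-justified). A partition $\alpha$ contains a partition $\mu$ if one can delete some rows and some columns of the Ferrers board of $\alpha$ and obtain the Ferrers board of $\mu$. $\mathcal{P}_n(\mu)$ denotes the set of partitions of weight $n$ that contain $\mu$. Two partitions are Wilf equivalent if $|\mathcal{P}_n(\mu)|=|\mathcal{P}_n(\tau)|$ for all $n\ge0$. Two partitions (Ferrers boards) are rook equivalent if, for every $j\ge 0$, the number of ways to place $j$ mutually non-attacking rooks (no two in the same row or column) on the Ferrers board of $\mu$ equals the corresponding number for $\tau$. *)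

theory Defs
  imports Main
begin

text \<open>
  A partition is a function on the row indices, where rows and columns are numbered from 0, so
  the part \<open>\<mu> i\<close> is the part usually written with index \<open>i + 1\<close>.
\<close>

definition is_partition :: "(nat \<Rightarrow> nat) \<Rightarrow> bool" where
  "is_partition \<mu> \<longleftrightarrow> antimono \<mu> \<and> finite {i. \<mu> i > 0}"

definition weight :: "(nat \<Rightarrow> nat) \<Rightarrow> nat" where
  "weight \<mu> = (\<Sum>i | \<mu> i > 0. \<mu> i)"

definition board :: "(nat \<Rightarrow> nat) \<Rightarrow> (nat \<times> nat) set" where
  "board \<mu> = {(i, j). j < \<mu> i}"

text \<open>
  Deleting the rows in \<open>R\<close> and the columns in \<open>C\<close>: a surviving line is renumbered by the number
  of surviving lines before it.
\<close>

definition delete_lines :: "nat set \<Rightarrow> nat set \<Rightarrow> (nat \<times> nat) set \<Rightarrow> (nat \<times> nat) set" where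
  "delete_lines R C B =
     (\<lambda>(i, j). (card ({..<i} - R), card ({..<j} - C))) ` {(i, j) \<in> B. i \<notin> R \<and> j \<notin> C}"

definition contains :: "(nat \<Rightarrow> nat) \<Rightarrow> (nat \<Rightarrow> nat) \<Rightarrow> bool" where
  "contains \<alpha> \<mu> \<longleftrightarrow> (\<exists>R C. delete_lines R C (board \<alpha>) = board \<mu>)"

definition partitions_containing :: "nat \<Rightarrow> (nat \<Rightarrow> nat) \<Rightarrow> (nat \<Rightarrow> nat) set" where
  "partitions_containing n \<mu> = {\<alpha>. is_partition \<alpha> \<and> weight \<alpha> = n \<and> contains \<alpha> \<mu>}"

definition wilf_equivalent :: "(nat \<Rightarrow> nat) \<Rightarrow> (nat \<Rightarrow> nat) \<Rightarrow> bool" where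
  "wilf_equivalent \<mu> \<tau> \<longleftrightarrow>
     (\<forall>n. card (partitions_containing n \<mu>) = card (partitions_containing n \<tau>))"

definition non_attacking :: "(nat \<times> nat) set \<Rightarrow> bool" where
  "non_attacking P \<longleftrightarrow> (\<forall>p\<in>P. \<forall>q\<in>P. p \<noteq> q \<longrightarrow> fst p \<noteq> fst q \<and> snd p \<noteq> snd q)"

definition rook_number :: "(nat \<times> nat) set \<Rightarrow> nat \<Rightarrow> nat" where
  "rook_number B j = card {P. P \<subseteq> B \<and> finite P \<and> card P = j \<and> non_attacking P}"

definition rook_equivalent :: "(nat \<Rightarrow> nat) \<Rightarrow> (nat \<Rightarrow> nat) \<Rightarrow> bool" where
  "rook_equivalent \<mu> \<tau> \<longleftrightarrow> (\<forall>j. rook_number (board \<mu>) j = rook_number (board \<tau>) j)"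

text \<open>
  The sets counted above are finite, so \<open>card\<close> never takes its default value 0 on them.
\<close>

lemma finite_board:
  assumes "is_partition \<mu>"
  shows "finite (board \<mu>)"
proof -
  have "board \<mu> = Sigma {i. \<mu> i > 0} (\<lambda>i. {..<\<mu> i})"
    by (auto simp: board_def)
  with assms show ?thesis
    by (simp add: is_partition_def)
qed

lemma finite_rook_placements:
  assumes "is_partition \<mu>"
  shows "finite {P. P \<subseteq> board \<mu> \<and> finite P \<and> card P = j \<and> non_attacking P}"
  by (rule finite_subset[of _ "Pow (board \<mu>)"]) (auto simp: finite_board[OF assms])

lemma finite_partitions_containing: "finite (partitions_containing n \<mu>)"
proof -
  have "\<alpha> i \<le> n \<and> (n \<le> i \<longrightarrow> \<alpha> i = 0)" if "\<alpha> \<in> partitions_containing n \<mu>" for \<alpha> i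
  proof -
    have fin: "finite {i. \<alpha> i > 0}" and anti: "antimono \<alpha>"
      and w: "(\<Sum>i | \<alpha> i > 0. \<alpha> i) = n"
      using that by (auto simp: partitions_containing_def is_partition_def weight_def)
    have "\<alpha> i \<le> n"
      using member_le_sum[of i "{i. \<alpha> i > 0}" \<alpha>] fin w by (cases "\<alpha> i > 0") auto
    moreover have "\<alpha> i = 0" if "n \<le> i"
    proof (rule ccontr)
      assume "\<alpha> i \<noteq> 0"
      have "{..i} \<subseteq> {i. \<alpha> i > 0}"
      proof
        fix k assume "k \<in> {..i}"
        then have "\<alpha> i \<le> \<alpha> k"
          using antimonoD[OF anti] by simp
        with \<open>\<alpha> i \<noteq> 0\<close> show "k \<in> {i. \<alpha> i > 0}"
          by simp
      qed
      then have "card {..i} \<le> card {i. \<alpha> i > 0}"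
        using fin by (rule card_mono[rotated])
      also have "\<dots> = (\<Sum>i | \<alpha> i > 0. 1)"
        by simp
      also have "\<dots> \<le> (\<Sum>i | \<alpha> i > 0. \<alpha> i)"
        by (rule sum_mono) auto
      finally show False
        using w that by simp
    qed
    ultimately show ?thesis by blast
  qed
  then have "partitions_containing n \<mu> \<subseteq>
      {f. \<forall>x. (x \<in> {..<n} \<longrightarrow> f x \<in> {..n}) \<and> (x \<notin> {..<n} \<longrightarrow> f x = 0)}"
    by (intro subsetI CollectI) simp
  moreover have "finite {f :: nat \<Rightarrow> nat.
      \<forall>x. (x \<in> {..<n} \<longrightarrow> f x \<in> {..n}) \<and> (x \<notin> {..<n} \<longrightarrow> f x = 0)}"
    by (rule finite_set_of_finite_funs) simp_all
  ultimately show ?thesis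
    by (rule finite_subset)
qed

end

theory Submission
  imports Defs "HOL-Library.Sublist" "HOL-Library.Infinite_Set" "HOL-Computational_Algebra.Polynomial"
begin

text \<open>
  A partition is read off its boundary, which is a word in two letters, and containment of
  partitions becomes the subsequence relation on words. Summing \<open>q ^ area\<close> over the words with
  \<open>b\<close> rows and \<open>a\<close> columns that contain \<open>w\<close> gives a function of \<open>b\<close> and \<open>a\<close>; the leftmost embedding
  shows that prepending a letter to \<open>w\<close> applies a linear operator, \<open>R\<close> for a row and \<open>C\<close> for a column.
  With the shifts \<open>x f b a = f b (a - 1)\<close> and \<open>y f b a = q ^ a * f (b - 1) a\<close>, where \<open>y x = q x y\<close>,
  one has \<open>R = (1 - x)\<^sup>-\<^sup>1 y\<close> and \<open>C = (1 - y)\<^sup>-\<^sup>1 x\<close>. Then \<open>C R = X q\<close> and \<open>C (X t) = X (q t) C\<close>, where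
  \<open>X t = (1 + t Z)\<^sup>-\<^sup>1\<close> for one fixed \<open>Z = (y x)\<^sup>-\<^sup>1 (1 - x - y)\<close>, so the \<open>X t\<close> commute. Since \<open>C\<close> is injective, it
  follows that the operator of the word of \<open>\<mu>\<close> depends only on the multiset of the numbers \<open>\<mu> i + i\<close>.
  By the Goldman--Joichi--White factorization of the factorial rook polynomial, the rook numbers
  determine this multiset.
\<close>

section \<open>Words and partitions\<close>

text \<open>
  The boundary is read from its upper right end: each row or column of a large rectangle
  contributes a letter, and a box lies in the partition iff the letter of its row precedes that
  of its column. Columns are thus met from the last one to the first.
\<close>

datatype line = Row | Col

primrec part :: "line list \<Rightarrow> nat \<Rightarrow> nat" where
  "part [] = (\<lambda>i. 0)"
| "part (x # v) = (case x of Row \<Rightarrow> case_nat (count_list v Col) (part v) | Col \<Rightarrow> part v)"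

primrec area :: "line list \<Rightarrow> nat" where
  "area [] = 0"
| "area (x # v) = (case x of Row \<Rightarrow> count_list v Col | Col \<Rightarrow> 0) + area v"

definition words :: "nat \<Rightarrow> nat \<Rightarrow> line list set" where
  "words b a = {v. count_list v Row = b \<and> count_list v Col = a}"

lemma length_word: "length v = count_list v Row + count_list v Col"
proof (induction v)
  case (Cons x v)
  then show ?case by (cases x) auto
qed simp

lemma finite_words: "finite (words b a)"
proof (rule finite_subset)
  have "(UNIV :: line set) = {Row, Col}"
    using line.exhaust by auto
  then have "finite (UNIV :: line set)"
    by (metis finite.emptyI finite.insertI)
  then show "finite {v :: line list. set v \<subseteq> UNIV \<and> length v = b + a}"
    by (rule finite_lists_length_eq)
qed (auto simp: words_def length_word)

lemma part_le: "part v i \<le> count_list v Col"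
proof (induction v arbitrary: i)
  case (Cons x v)
  show ?case
    using Cons[of i] Cons[of "i - 1"] by (cases x; cases i) auto
qed simp

lemma part_eq_0: "count_list v Row \<le> i \<Longrightarrow> part v i = 0"
proof (induction v arbitrary: i)
  case (Cons x v)
  then show ?case
    by (cases x; cases i) auto
qed simp

lemma antimono_part: "antimono (part v)"
proof (induction v)
  case (Cons x v)
  show ?case
  proof (cases x)
    case Row
    have "part (x # v) i \<ge> part (x # v) j" if "i \<le> j" for i j
      using that part_le[of v] antimonoD[OF Cons, of "i - 1" "j - 1"] Row
      by (cases i; cases j) auto
    then show ?thesis
      by (simp add: antimono_def)
  qed (use Cons in simp)
qed (simp add: antimono_def)

lemma is_partition_part: "is_partition (part v)"
proof -
  have "{i. part v i > 0} \<subseteq> {..<count_list v Row}"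
    using part_eq_0 by (metis (mono_tags) lessThan_iff linorder_not_le mem_Collect_eq neq0_conv subsetI)
  then show ?thesis
    using antimono_part finite_subset by (auto simp: is_partition_def)
qed

lemma weight_eq_sum:
  assumes "\<And>i. b \<le> i \<Longrightarrow> \<mu> i = 0"
  shows "weight \<mu> = (\<Sum>i<b. \<mu> i)"
proof -
  have "{i. \<mu> i > 0} \<subseteq> {..<b}"
    using assms by (metis (mono_tags) lessThan_iff linorder_not_le mem_Collect_eq neq0_conv subsetI)
  then show ?thesis
    unfolding weight_def by (intro sum.mono_neutral_left) auto
qed

lemma weight_part: "weight (part v) = area v"
proof -
  have "(\<Sum>i<count_list v Row. part v i) = area v"
  proof (induction v)
    case (Cons x v)
    then show ?case
      by (cases x) (auto simp: sum.lessThan_Suc_shift simp del: sum.lessThan_Suc)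
  qed simp
  then show ?thesis
    using weight_eq_sum[of "count_list v Row" "part v"] part_eq_0 by simp
qed

text \<open>The first letter can be recovered from the partition: a leading \<open>Row\<close> makes
  the largest part equal to the number of all columns, while a leading \<open>Col\<close> makes it
  smaller.\<close>

lemma inj_on_part: "inj_on part (words b a)"
proof -
  have "v = v'" if "part v = part v'" "count_list v Row = count_list v' Row"
    "count_list v Col = count_list v' Col" for v v'
    using that
  proof (induction v arbitrary: v')
    case Nil
    then show ?case
      using length_word[of v'] by simp
  next
    case (Cons x v)
    from Cons.prems(2,3) obtain y u where v': "v' = y # u"
      by (cases v'; cases x) auto
    show ?case
    proof (cases "x = y")
      case True
      have "part v = part u"
        using Cons.prems(1) True v'
        by (cases y) (auto simp: fun_eq_iff split: nat.splits)
      then show ?thesis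
        using Cons v' True by (cases y) auto
    next
      case False
      then show ?thesis
        using Cons.prems fun_cong[OF Cons.prems(1), of 0] part_le[of v 0] part_le[of u 0] v'
        by (cases x; cases y) auto
    qed
  qed
  then show ?thesis
    by (auto simp: inj_on_def words_def)
qed

text \<open>Induction on \<open>b + a\<close>. If the last column of the rectangle is empty, the
  word begins with \<open>Col\<close>; otherwise the first row fills the whole width and the word
  begins with \<open>Row\<close>.\<close>

lemma ex_word:
  assumes "antimono \<mu>" "\<mu> 0 \<le> a" "\<And>i. b \<le> i \<Longrightarrow> \<mu> i = 0"
  shows "\<exists>v\<in>words b a. part v = \<mu>"
  using assms
proof (induction "b + a" arbitrary: b a \<mu>)
  case 0
  then show ?case
    by (auto simp: words_def fun_eq_iff intro!: exI[of _ "[]"])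
next
  case (Suc n)
  show ?case
  proof (cases "\<mu> 0 < a")
    case True
    then obtain v where "v \<in> words b (a - 1)" "part v = \<mu>"
      using Suc.hyps(1)[of b "a - 1" \<mu>] Suc by fastforce
    then show ?thesis
      using True by (intro bexI[of _ "Col # v"]) (auto simp: words_def)
  next
    case False
    then have a: "\<mu> 0 = a"
      using Suc.prems by simp
    have "b \<noteq> 0"
      using Suc.prems(3)[of 0] Suc.hyps(2) a by auto
    then obtain b' where b: "b = Suc b'"
      by (cases b) auto
    have "antimono (\<lambda>i. \<mu> (Suc i))"
      using Suc.prems(1) by (simp add: antimono_def)
    moreover have "\<mu> (Suc 0) \<le> a"
      using antimonoD[OF Suc.prems(1), of 0 "Suc 0"] a by simp
    ultimately obtain v where v: "v \<in> words b' a" "part v = (\<lambda>i. \<mu> (Suc i))"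
      using Suc.hyps(1)[of b' a "\<lambda>i. \<mu> (Suc i)"] Suc.hyps(2) Suc.prems(3) b by auto
    have "part (Row # v) = \<mu>"
      using v a by (auto simp: words_def fun_eq_iff split: nat.splits)
    then show ?thesis
      using v b by (intro bexI[of _ "Row # v"]) (auto simp: words_def)
  qed
qed

section \<open>Containment as a subsequence relation\<close>

text \<open>\<open>r\<close> and \<open>c\<close> enumerate the surviving rows and columns. Being
  total, they require infinitely many survivors; for a partition this loses nothing, because only
  finitely many lines meet its board.\<close>

definition embeds :: "(nat \<Rightarrow> nat) \<Rightarrow> (nat \<Rightarrow> nat) \<Rightarrow> (nat \<Rightarrow> nat) \<Rightarrow> (nat \<Rightarrow> nat) \<Rightarrow> bool" where
  "embeds r c \<mu> \<alpha> \<longleftrightarrow> strict_mono r \<and> strict_mono c \<and> (\<forall>i j. c j < \<alpha> (r i) \<longleftrightarrow> j < \<mu> i)"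

lemma card_lessThan_Int_range:
  fixes r :: "nat \<Rightarrow> nat"
  assumes "strict_mono r"
  shows "card ({..<r i} \<inter> range r) = i"
proof -
  have "{..<r i} \<inter> range r = r ` {..<i}"
    using assms by (auto simp: strict_mono_less)
  moreover have "inj_on r {..<i}"
    using strict_mono_imp_inj_on[OF assms] inj_on_subset by blast
  ultimately show ?thesis
    by (simp add: card_image)
qed

text \<open>Exactly \<open>i\<close> survivors precede \<open>r i\<close>, so the renumbering in
  \<open>delete_lines\<close> inverts the two enumerations.\<close>

lemma delete_lines_range:
  assumes "strict_mono r" "strict_mono c"
  shows "delete_lines (- range r) (- range c) B = {(i, j). (r i, c j) \<in> B}"
  using card_lessThan_Int_range[OF assms(1)] card_lessThan_Int_range[OF assms(2)]
  by (fastforce simp: delete_lines_def Diff_eq image_iff)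

lemma embeds_imp_contains:
  assumes "embeds r c \<mu> \<alpha>"
  shows "contains \<alpha> \<mu>"
  using assms delete_lines_range[of r c "board \<alpha>"]
  by (auto simp: embeds_def contains_def board_def)

lemma contains_imp_embeds:
  assumes "is_partition \<alpha>" "contains \<alpha> \<mu>"
  shows "\<exists>r c. embeds r c \<mu> \<alpha>"
proof -
  obtain R C where RC: "delete_lines R C (board \<alpha>) = board \<mu>"
    using assms(2) by (auto simp: contains_def)
  have anti: "\<alpha> i \<le> \<alpha> k" if "k \<le> i" for i k
    using assms(1) that by (auto simp: is_partition_def dest: antimonoD)
  \<comment> \<open>Only lines that meet the board stay deleted. All lines before a box meet the
    board, so the renumbering of boxes is unchanged, and the complements become infinite and can be
    enumerated.\<close>
  define R' where "R' = R \<inter> {i. \<alpha> i > 0}"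
  define C' where "C' = C \<inter> {..<\<alpha> 0}"
  have fin: "infinite (- R')" "infinite (- C')"
    using assms(1) by (auto simp: R'_def C'_def is_partition_def Compl_eq_Diff_UNIV intro: Diff_infinite_finite)
  have "i \<in> R' \<longleftrightarrow> i \<in> R" "j \<in> C' \<longleftrightarrow> j \<in> C" "{..<i} - R' = {..<i} - R" "{..<j} - C' = {..<j} - C"
    if "(i, j) \<in> board \<alpha>" for i j
  proof -
    have "\<alpha> k > 0" if "k \<le> i" for k
      using anti[OF that] \<open>(i, j) \<in> board \<alpha>\<close> by (auto simp: board_def)
    moreover have "j < \<alpha> 0"
      using anti[of 0 i] that by (auto simp: board_def)
    ultimately show "i \<in> R' \<longleftrightarrow> i \<in> R" "j \<in> C' \<longleftrightarrow> j \<in> C"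
        "{..<i} - R' = {..<i} - R" "{..<j} - C' = {..<j} - C"
      by (auto simp: R'_def C'_def)
  qed
  then have "delete_lines R' C' (board \<alpha>) = delete_lines R C (board \<alpha>)"
    unfolding delete_lines_def by (intro image_cong) auto
  moreover have "- range (enumerate (- R')) = R'" "- range (enumerate (- C')) = C'"
    using fin by (simp_all add: range_enumerate)
  moreover have sm: "strict_mono (enumerate (- R'))" "strict_mono (enumerate (- C'))"
    using fin by (simp_all add: strict_mono_enumerate)
  ultimately have "{(i, j). (enumerate (- R') i, enumerate (- C') j) \<in> board \<alpha>} = board \<mu>"
    using delete_lines_range[OF sm, of "board \<alpha>"] RC by simp
  then show ?thesis
    using sm by (auto simp: embeds_def board_def set_eq_iff)
qed

lemma contains_iff_embeds: "is_partition \<alpha> \<Longrightarrow> contains \<alpha> \<mu> \<longleftrightarrow> (\<exists>r c. embeds r c \<mu> \<alpha>)"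
  using contains_imp_embeds embeds_imp_contains by blast

lemma strict_mono_splice:
  fixes c :: "nat \<Rightarrow> nat"
  assumes "strict_mono c" "\<And>j. j < a \<Longrightarrow> c j < A"
  shows "strict_mono (\<lambda>j. if j < a then c j else A + (j - a))"
proof (rule strict_monoI)
  fix i j :: nat assume "i < j"
  then show "(if i < a then c i else A + (i - a)) < (if j < a then c j else A + (j - a))"
    using strict_monoD[OF assms(1), of i j] assms(2)[of i] by auto
qed

text \<open>The columns of \<open>\<mu>\<close> from \<open>a\<close> on are empty, so their images
  can be moved beyond the width \<open>A\<close> of \<open>\<alpha>\<close>.\<close>

lemma embeds_splice:
  assumes "embeds r c \<mu> \<alpha>" "\<And>i. \<mu> i \<le> a" "\<And>i. \<alpha> i \<le> A" "\<And>j. j < a \<Longrightarrow> c j < A"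
  shows "embeds r (\<lambda>j. if j < a then c j else A + (j - a)) \<mu> \<alpha>"
proof -
  have "(if j < a then c j else A + (j - a)) < \<alpha> (r i) \<longleftrightarrow> j < \<mu> i" for i j
    using assms(1) assms(2)[of i] assms(3)[of "r i"] by (auto simp: embeds_def)
  then show ?thesis
    using assms(1,4) strict_mono_splice[of c a A] by (simp add: embeds_def)
qed

text \<open>The condition on \<open>c\<close> strengthens the induction: a matched leading
  \<open>Row\<close> is a full row in both partitions, and the condition is what the embedding
  demands of it.\<close>

lemma subseq_imp_embeds:
  assumes "subseq w v"
  shows "\<exists>r c. embeds r c (part w) (part v) \<and> (\<forall>j. c j < count_list v Col \<longleftrightarrow> j < count_list w Col)"
  using assms
proof (induction rule: list_emb.induct)
  case (list_emb_Nil v)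
  have "embeds (\<lambda>i. i + count_list v Row) (\<lambda>j. j + count_list v Col) (part []) (part v)"
    using part_eq_0[of v] by (auto simp: embeds_def strict_mono_def)
  then show ?case
    by (intro exI[of _ "\<lambda>i. i + count_list v Row"] exI[of _ "\<lambda>j. j + count_list v Col"]) auto
next
  case (list_emb_Cons w v x)
  then obtain r c where rc: "embeds r c (part w) (part v)"
    "\<forall>j. c j < count_list v Col \<longleftrightarrow> j < count_list w Col"
    by blast
  show ?case
  proof (cases x)
    case Row
    have "embeds (Suc \<circ> r) c (part w) (part (x # v))"
      using rc(1) Row by (auto simp: embeds_def strict_mono_def)
    then show ?thesis
      using rc(2) Row by auto
  next
    case Col
    \<comment> \<open>The unmatched new column has index \<open>count_list v Col\<close>;
      \<open>c'\<close> skips it.\<close>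
    define c' where
      "c' = (\<lambda>j. if j < count_list w Col then c j else Suc (count_list v Col) + (j - count_list w Col))"
    have "c j < Suc (count_list v Col)" if "j < count_list w Col" for j
      using rc(2) that by (simp add: less_SucI)
    then have "embeds r c' (part w) (part v)"
      unfolding c'_def by (intro embeds_splice[OF rc(1) part_le]) (simp_all add: part_le le_SucI)
    moreover have "c' j < Suc (count_list v Col) \<longleftrightarrow> j < count_list w Col" for j
    proof (cases "j < count_list w Col")
      case True
      then have "c j < count_list v Col"
        using rc(2) by blast
      with True show ?thesis
        by (simp add: c'_def)
    qed (simp add: c'_def)
    ultimately show ?thesis
      using Col by (intro exI[of _ r] exI[of _ c']) simp
  qed
next
  case (list_emb_Cons2 x y w v)
  then have [simp]: "y = x" by simp
  from list_emb_Cons2.IH obtain r c where rc: "embeds r c (part w) (part v)"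
    "\<forall>j. c j < count_list v Col \<longleftrightarrow> j < count_list w Col"
    by blast
  show ?case
  proof (cases x)
    case Row
    have "strict_mono (case_nat 0 (Suc \<circ> r))"
      using rc(1) by (auto simp: embeds_def strict_mono_def split: nat.splits)
    moreover have "c j < part (y # v) (case_nat 0 (Suc \<circ> r) i) \<longleftrightarrow> j < part (x # w) i" for i j
      using rc Row by (cases i) (auto simp: embeds_def)
    ultimately have "embeds (case_nat 0 (Suc \<circ> r)) c (part (x # w)) (part (y # v))"
      using rc(1) by (simp add: embeds_def)
    then show ?thesis
      using rc(2) Row by auto
  next
    case Col
    \<comment> \<open>The new column \<open>count_list w Col\<close> is sent to the new column
      \<open>count_list v Col\<close>.\<close>
    define c' where
      "c' = (\<lambda>j. if j < count_list w Col then c j else count_list v Col + (j - count_list w Col))"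
    have "embeds r c' (part w) (part v)"
      unfolding c'_def using rc(2) by (intro embeds_splice[OF rc(1) part_le part_le]) simp
    moreover have "c' j < Suc (count_list v Col) \<longleftrightarrow> j < Suc (count_list w Col)" for j
    proof (cases "j < count_list w Col")
      case True
      then have "c j < count_list v Col"
        using rc(2) by blast
      with True show ?thesis
        by (simp add: c'_def)
    qed (auto simp: c'_def)
    ultimately show ?thesis
      using Col by (intro exI[of _ r] exI[of _ c']) simp
  qed
qed

text \<open>The word \<open>v\<close> is read letter by letter. A leading \<open>Row\<close> is row
  0, a leading \<open>Col\<close> is the last column; if the embedding hits that line,
  \<open>w\<close> must begin with the same letter and both letters are removed, otherwise the
  letter of \<open>v\<close> is skipped.\<close>

lemma subseq_if_finite_embedding:
  assumes "strict_mono r" "strict_mono c"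
    and "\<And>i. i < count_list w Row \<Longrightarrow> r i < count_list v Row"
    and "\<And>j. j < count_list w Col \<Longrightarrow> c j < count_list v Col"
    and "\<And>i j. i < count_list w Row \<Longrightarrow> j < count_list w Col \<Longrightarrow> c j < part v (r i) \<longleftrightarrow> j < part w i"
  shows "subseq w v"
  using assms
proof (induction v arbitrary: w r c)
  case Nil
  then have "w = []"
    using length_word[of w] by (metis count_list.simps(1) gr0I length_0_conv add_is_0 not_less0)
  then show ?case by simp
next
  case (Cons x v)
  show ?case
  proof (cases w)
    case w: (Cons y u)
    show ?thesis
    proof (cases x)
      case Row
      show ?thesis
      proof (cases "r 0 = 0 \<and> count_list w Row > 0")
        case True
        \<comment> \<open>Otherwise the last column of \<open>w\<close> is empty, yet its image
          meets the full row 0 of \<open>x # v\<close>.\<close>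
        have "y = Row"
        proof (rule ccontr)
          assume "y \<noteq> Row"
          then have y: "y = Col" by (cases y) auto
          have "c (count_list u Col) < part (x # v) (r 0)"
            using Cons.prems(4)[of "count_list u Col"] True Row w y by simp
          then have "count_list u Col < part u 0"
            using Cons.prems(5)[of 0 "count_list u Col"] True w y by simp
          then show False
            using part_le[of u 0] by simp
        qed
        have pos: "r (Suc i) > 0" for i
          using strict_monoD[OF Cons.prems(1), of 0 "Suc i"] by simp
        have sm: "strict_mono (\<lambda>i. r (Suc i) - 1)"
          using pos strict_monoD[OF Cons.prems(1)]
          by (intro strict_monoI) (metis Suc_less_eq Suc_pred' diff_Suc_1)
        have "subseq u v"
        proof (rule Cons.IH[OF sm Cons.prems(2)])
          fix i assume "i < count_list u Row"
          then show "r (Suc i) - 1 < count_list v Row"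
            using Cons.prems(3)[of "Suc i"] w \<open>y = Row\<close> Row pos[of i] by simp
        next
          fix j assume "j < count_list u Col"
          then show "c j < count_list v Col"
            using Cons.prems(4)[of j] w \<open>y = Row\<close> Row by simp
        next
          fix i j assume "i < count_list u Row" "j < count_list u Col"
          then show "c j < part v (r (Suc i) - 1) \<longleftrightarrow> j < part u i"
            using Cons.prems(5)[of "Suc i" j] w \<open>y = Row\<close> Row pos[of i]
            by (auto simp: gr0_conv_Suc)
        qed
        then show ?thesis
          using w \<open>y = Row\<close> Row by simp
      next
        case False
        have "subseq w v"
        proof (cases "count_list w Row")
          case 0
          then show ?thesis
            using Cons.prems(4) Row by (intro Cons.IH[OF Cons.prems(1,2)]) auto
        next
          case (Suc n)
          have pos: "r i > 0" for i
            using False Suc strict_mono_leD[OF Cons.prems(1), of 0 i] by simp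
          have sm: "strict_mono (\<lambda>i. r i - 1)"
            using pos strict_monoD[OF Cons.prems(1)]
            by (intro strict_monoI) (metis Suc_less_eq Suc_pred' diff_Suc_1)
          show ?thesis
          proof (rule Cons.IH[OF sm Cons.prems(2)])
            fix i assume "i < count_list w Row"
            then show "r i - 1 < count_list v Row"
              using Cons.prems(3)[of i] Row pos[of i] by simp
          next
            fix j assume "j < count_list w Col"
            then show "c j < count_list v Col"
              using Cons.prems(4)[of j] Row by simp
          next
            fix i j assume "i < count_list w Row" "j < count_list w Col"
            then show "c j < part v (r i - 1) \<longleftrightarrow> j < part w i"
              using Cons.prems(5)[of i j] Row pos[of i] by (auto simp: gr0_conv_Suc)
          qed
        qed
        then show ?thesis by auto
      qed
    next
      case Col
      show ?thesis
      proof (cases "\<exists>j < count_list w Col. c j = count_list v Col")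
        case True
        then obtain j where j: "j < count_list w Col" "c j = count_list v Col" by blast
        \<comment> \<open>Otherwise row 0 of \<open>w\<close> is full and has a box in column
          \<open>j\<close>, whose image is an empty column.\<close>
        have "y = Col"
        proof (rule ccontr)
          assume "y \<noteq> Col"
          then have y: "y = Row" by (cases y) auto
          then show False
            using Cons.prems(5)[of 0 j] j w Col part_le[of v "r 0"] by simp
        qed
        have lt: "c i < count_list v Col" if "i < count_list u Col" for i
          using Cons.prems(4)[of "Suc i"] strict_monoD[OF Cons.prems(2), of i "Suc i"] that w \<open>y = Col\<close> Col
          by simp
        have "subseq u v"
          using lt Cons.prems(3,5) w \<open>y = Col\<close> Col
          by (intro Cons.IH[OF Cons.prems(1,2)]) auto
        then show ?thesis
          using w \<open>y = Col\<close> Col by simp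
      next
        case False
        have "subseq w v"
          using Cons.prems(3-5) False Col
          by (intro Cons.IH[OF Cons.prems(1,2)]) (auto simp: less_Suc_eq)
        then show ?thesis
          by auto
      qed
    qed
  qed simp
qed

section \<open>Commuting operators\<close>

text \<open>\<open>row_op q g\<close> solves \<open>h = x h + y g\<close> and
  \<open>col_op q g\<close> solves \<open>h = y h + x g\<close>, where values at negative arguments
  count as 0.\<close>

fun row_op :: "real \<Rightarrow> (nat \<Rightarrow> nat \<Rightarrow> real) \<Rightarrow> nat \<Rightarrow> nat \<Rightarrow> real" where
  "row_op q g 0 a = 0"
| "row_op q g (Suc b) 0 = g b 0"
| "row_op q g (Suc b) (Suc a) = row_op q g (Suc b) a + q ^ Suc a * g b (Suc a)"

fun col_op :: "real \<Rightarrow> (nat \<Rightarrow> nat \<Rightarrow> real) \<Rightarrow> nat \<Rightarrow> nat \<Rightarrow> real" where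
  "col_op q g b 0 = 0"
| "col_op q g 0 (Suc a) = g 0 a"
| "col_op q g (Suc b) (Suc a) = g (Suc b) a + q ^ Suc a * col_op q g b (Suc a)"

text \<open>The operator \<open>X t\<close>: the solution \<open>h\<close> of \<open>t (h - x h - y h) = y x (g - h)\<close>.\<close>

fun mix_op :: "real \<Rightarrow> real \<Rightarrow> (nat \<Rightarrow> nat \<Rightarrow> real) \<Rightarrow> nat \<Rightarrow> nat \<Rightarrow> real" where
  "mix_op q t g 0 a = 0"
| "mix_op q t g (Suc b) 0 = 0"
| "mix_op q t g (Suc b) (Suc a) = mix_op q t g (Suc b) a + q ^ Suc a * mix_op q t g b (Suc a)
     + q ^ Suc a / t * (g b a - mix_op q t g b a)"

lemma mix_op_0 [simp]: "mix_op q t g b 0 = 0"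
  by (cases b) auto

text \<open>For \<open>t \<noteq> 0\<close> the equation determines each value from those with a
  smaller row or column argument. Identities between operators are thus checked on the defining
  equation, without inverting anything.\<close>

lemma mix_op_unique:
  assumes h: "\<And>a. h 0 a = 0" "\<And>b. h b 0 = 0"
    and eq: "\<And>a b. t * (h (Suc b) (Suc a) - h (Suc b) a - q ^ Suc a * h b (Suc a)) =
      q ^ Suc a * (g b a - h b a)"
    and "t \<noteq> 0"
  shows "h = mix_op q t g"
proof -
  have rec: "h (Suc b) (Suc a) =
      h (Suc b) a + q ^ Suc a * h b (Suc a) + q ^ Suc a / t * (g b a - h b a)" for a b
    using eq[of b a] \<open>t \<noteq> 0\<close> by (simp add: field_simps)
  have "h b a = mix_op q t g b a" for b a
  proof (induction b arbitrary: a)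
    case (Suc b)
    then show ?case
      by (induction a) (simp_all add: h rec)
  qed (simp add: h)
  then show ?thesis
    by (simp add: fun_eq_iff)
qed

lemma mix_op_eq:
  assumes "t \<noteq> 0"
  shows "t * (mix_op q t g (Suc b) (Suc a) - mix_op q t g (Suc b) a - q ^ Suc a * mix_op q t g b (Suc a)) =
      q ^ Suc a * (g b a - mix_op q t g b a)"
  using assms by (simp add: field_simps)

text \<open>For \<open>r = row_op q g\<close> and \<open>h = col_op q r\<close>, both sides of the
  defining equation equal \<open>q x (r - h)\<close>, by the two recursions and
  \<open>y x = q x y\<close>.\<close>

lemma col_op_row_op:
  assumes "q \<noteq> 0"
  shows "col_op q (row_op q g) = mix_op q q g"
proof (rule mix_op_unique)
  show "col_op q (row_op q g) 0 a = 0" for a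
    by (cases a) auto
  fix a b
  show "q * (col_op q (row_op q g) (Suc b) (Suc a) - col_op q (row_op q g) (Suc b) a
      - q ^ Suc a * col_op q (row_op q g) b (Suc a)) =
      q ^ Suc a * (g b a - col_op q (row_op q g) b a)"
    by (cases a; cases b) (auto simp: algebra_simps)
qed (use assms in auto)

lemma col_op_mix_op:
  assumes "q \<noteq> 0" "t \<noteq> 0"
  shows "col_op q (mix_op q t g) = mix_op q (q * t) (col_op q g)"
proof (rule mix_op_unique)
  let ?h = "mix_op q t g"
  let ?c = "col_op q (mix_op q t g)"
  let ?d = "col_op q g"
  show c0: "?c 0 a = 0" for a
    by (cases a) auto
  \<comment> \<open>This is \<open>t (h - c) = y (d - c)\<close>. It suffices:
    \<open>c - y c = x h\<close> turns the left side of the goal into \<open>q t x (h - c)\<close>,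
    and the right side is \<open>y x (d - c) = q x y (d - c)\<close>.\<close>
  have "t * (?h b a - ?c b a) = (case b of 0 \<Rightarrow> 0 | Suc b' \<Rightarrow> q ^ a * (?d b' a - ?c b' a))" for b a
  proof (induction b)
    case 0
    then show ?case
      using c0 by simp
  next
    case (Suc b)
    show ?case
    proof (cases a)
      case (Suc a')
      have d: "?d b a = g b a' + (case b of 0 \<Rightarrow> 0 | Suc b' \<Rightarrow> q ^ a * ?d b' a)"
        using Suc by (cases b) auto
      have c: "?c b a = ?h b a' + (case b of 0 \<Rightarrow> 0 | Suc b' \<Rightarrow> q ^ a * ?c b' a)"
        using Suc by (cases b) auto
      have IH: "t * (?h b a - ?c b a) = ?d b a - ?c b a - (g b a' - ?h b a')"
        unfolding d c using Suc.IH c d by (cases b) (simp_all add: algebra_simps)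
      \<comment> \<open>From \<open>c = y c + x h\<close> one has
        \<open>h - c = (h - x h - y h) + y (h - c)\<close>; the first summand is known from the
        equation of \<open>h\<close>, the second from the induction hypothesis.\<close>
      have "t * (?h (Suc b) a - ?c (Suc b) a) =
         t * (?h (Suc b) a - ?h (Suc b) a' - q ^ a * ?h b a) + q ^ a * (t * (?h b a - ?c b a))"
        using Suc by (simp add: algebra_simps del: mix_op.simps)
      also have "\<dots> = q ^ a * (?d b a - ?c b a)"
        unfolding Suc mix_op_eq[OF assms(2)] IH[unfolded Suc] by (simp add: algebra_simps)
      finally show ?thesis by simp
    qed auto
  qed
  from this[of "Suc b" a for b a]
  have u: "t * (?h (Suc b) a - ?c (Suc b) a) = q ^ a * (?d b a - ?c b a)" for b a
    by simp
  fix a b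
  have "q * t * (?c (Suc b) (Suc a) - ?c (Suc b) a - q ^ Suc a * ?c b (Suc a)) =
      q * (t * (?h (Suc b) a - ?c (Suc b) a))"
    by (simp del: mix_op.simps add: algebra_simps)
  also have "\<dots> = q ^ Suc a * (?d b a - ?c b a)"
    unfolding u by simp
  finally show "q * t * (?c (Suc b) (Suc a) - ?c (Suc b) a - q ^ Suc a * ?c b (Suc a)) =
      q ^ Suc a * (?d b a - ?c b a)" .
qed (use assms in auto)

lemma mix_op_combination:
  assumes "s \<noteq> 0" "t \<noteq> 0"
  shows "s * mix_op q s g b a - t * mix_op q t g b a = (s - t) * mix_op q t (mix_op q s g) b a"
proof (cases "s = t")
  case False
  \<comment> \<open>The partial fraction expansion of \<open>(1 + s Z)\<^sup>-\<^sup>1 (1 + t Z)\<^sup>-\<^sup>1\<close>.\<close>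
  let ?h = "\<lambda>b a. (s * mix_op q s g b a - t * mix_op q t g b a) / (s - t)"
  have "?h = mix_op q t (mix_op q s g)"
  proof (rule mix_op_unique)
    fix a b
    have "t * (?h (Suc b) (Suc a) - ?h (Suc b) a - q ^ Suc a * ?h b (Suc a)) =
       t * (s * (mix_op q s g (Suc b) (Suc a) - mix_op q s g (Suc b) a - q ^ Suc a * mix_op q s g b (Suc a))
        - t * (mix_op q t g (Suc b) (Suc a) - mix_op q t g (Suc b) a - q ^ Suc a * mix_op q t g b (Suc a))) / (s - t)"
      using False by (simp del: mix_op.simps add: divide_simps) (simp del: mix_op.simps add: algebra_simps)
    also have "\<dots> = q ^ Suc a * (mix_op q s g b a - ?h b a)"
      unfolding mix_op_eq[OF assms(1)] mix_op_eq[OF assms(2)]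
      using False by (simp del: mix_op.simps add: divide_simps) (simp del: mix_op.simps add: algebra_simps)
    finally show "t * (?h (Suc b) (Suc a) - ?h (Suc b) a - q ^ Suc a * ?h b (Suc a)) =
      q ^ Suc a * (mix_op q s g b a - ?h b a)" .
  qed (use assms in auto)
  then show ?thesis
    using False by (auto simp: fun_eq_iff field_simps)
qed auto

text \<open>Exchanging \<open>s\<close> and \<open>t\<close> negates the left side of
  \<open>mix_op_combination\<close>; compare the two right sides and cancel
  \<open>s - t\<close>.\<close>

lemma mix_op_commute:
  assumes "s \<noteq> 0" "t \<noteq> 0"
  shows "mix_op q s (mix_op q t g) = mix_op q t (mix_op q s g)"
proof (cases "s = t")
  case False
  have "(s - t) * mix_op q t (mix_op q s g) b a = (s - t) * mix_op q s (mix_op q t g) b a" for b a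
    using mix_op_combination[OF assms, of q g b a] mix_op_combination[OF assms(2,1), of q g b a]
    by (simp add: algebra_simps)
  then show ?thesis
    using False by (auto simp: fun_eq_iff)
qed auto

text \<open>\<open>g\<close> is recovered from \<open>x g = (1 - y) (C g)\<close>.\<close>

lemma inj_col_op: "inj (col_op q)"
proof (rule injI)
  fix g h assume eq: "col_op q g = col_op q h"
  have "g b a = h b a" for b a
  proof (cases b)
    case 0
    then show ?thesis
      using fun_cong[OF fun_cong[OF eq], of b "Suc a"] by simp
  next
    case (Suc b')
    then show ?thesis
      using fun_cong[OF fun_cong[OF eq], of b "Suc a"] fun_cong[OF fun_cong[OF eq], of b' "Suc a"] by simp
  qed
  then show "g = h"
    by (simp add: fun_eq_iff)
qed

text \<open>
  The exponents \<open>e\<close> of the factors \<open>X (q ^ e)\<close> that appear when \<open>C ^ k\<close> is moved to the right through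
  the operators of the letters: each row turns one \<open>C\<close> into a factor.
\<close>

primrec col_exps :: "nat \<Rightarrow> line list \<Rightarrow> nat list" where
  "col_exps k [] = []"
| "col_exps k (x # w) = (case x of Row \<Rightarrow> k # col_exps (k - 1) w | Col \<Rightarrow> col_exps (Suc k) w)"

primrec word_op :: "real \<Rightarrow> line list \<Rightarrow> (nat \<Rightarrow> nat \<Rightarrow> real) \<Rightarrow> nat \<Rightarrow> nat \<Rightarrow> real" where
  "word_op q [] g = g"
| "word_op q (x # w) g = (case x of Row \<Rightarrow> row_op q | Col \<Rightarrow> col_op q) (word_op q w g)"

lemma col_op_power_mix_op:
  assumes "q \<noteq> 0" "t \<noteq> 0"
  shows "(col_op q ^^ k) (mix_op q t g) = mix_op q (q ^ k * t) ((col_op q ^^ k) g)"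
proof (induction k)
  case (Suc k)
  have "(col_op q ^^ Suc k) (mix_op q t g) = col_op q (mix_op q (q ^ k * t) ((col_op q ^^ k) g))"
    by (simp only: funpow.simps comp_apply Suc.IH)
  also have "\<dots> = mix_op q (q * (q ^ k * t)) (col_op q ((col_op q ^^ k) g))"
    using assms by (intro col_op_mix_op) simp_all
  finally show ?case
    by (simp add: mult.assoc)
qed simp

text \<open>At a row, \<open>C ^ k R = C ^ (k - 1) (X q) = X (q ^ k) C ^ (k - 1)\<close>; the bound
  on \<open>k\<close> ensures that every row finds a \<open>C\<close> to absorb. The list is
  reversed because \<open>fold\<close> applies its head first, whereas the first letter gives the
  outermost operator.\<close>

lemma col_op_power_word_op:
  assumes "q \<noteq> 0" "count_list w Row \<le> k"
  shows "(col_op q ^^ k) (word_op q w g) =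
    fold (\<lambda>e. mix_op q (q ^ e)) (rev (col_exps k w))
      ((col_op q ^^ (k + count_list w Col - count_list w Row)) g)"
  using assms(2)
proof (induction w arbitrary: k)
  case (Cons x w)
  show ?case
  proof (cases x)
    case Row
    then obtain k' where k: "k = Suc k'"
      using Cons.prems by (cases k) auto
    have "(col_op q ^^ k) (word_op q (x # w) g) = mix_op q (q ^ k) ((col_op q ^^ k') (word_op q w g))"
      using Row k assms(1) by (simp add: funpow_swap1 col_op_row_op col_op_power_mix_op mult.commute)
    then show ?thesis
      using Cons.IH[of k'] Cons.prems Row k by simp
  next
    case Col
    have "(col_op q ^^ k) (word_op q (x # w) g) = (col_op q ^^ Suc k) (word_op q w g)"
      using Col by (simp add: funpow_swap1)
    then show ?thesis
      using Cons.IH[of "Suc k"] Cons.prems Col by simp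
  qed
qed simp

text \<open>Before the letter of row \<open>i\<close> there are
  \<open>count_list w Col - part w i\<close> columns, each adding 1 to the exponent, and
  \<open>i\<close> rows, each subtracting 1.\<close>

lemma col_exps_eq:
  assumes "count_list w Row \<le> k"
  shows "col_exps k w = map (\<lambda>i. k + (count_list w Col - part w i) - i) [0..<count_list w Row]"
  using assms
proof (induction w arbitrary: k)
  case (Cons x w)
  show ?case
  proof (cases x)
    case Row
    then show ?thesis
      using Cons by (simp add: upt_conv_Cons map_Suc_upt[symmetric] del: upt_Suc)
  next
    case Col
    then show ?thesis
      using Cons part_le[of w] by (auto simp: Suc_diff_le) (metis Suc_diff_le diff_diff_left trans_le_add2)
  qed
qed simp

lemma word_op_cong:
  assumes "q \<noteq> 0" "v \<in> words k k" "w \<in> words k k"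
    and "image_mset (\<lambda>i. part v i + i) (mset_set {..<k}) = image_mset (\<lambda>i. part w i + i) (mset_set {..<k})"
  shows "word_op q v g = word_op q w g"
proof -
  \<comment> \<open>In a square word the exponent of row \<open>i\<close> is
    \<open>2 * k - (part u i + i)\<close>.\<close>
  have exps: "mset (col_exps k u) = image_mset (\<lambda>e. 2 * k - e) (image_mset (\<lambda>i. part u i + i) (mset_set {..<k}))"
    if "u \<in> words k k" for u
  proof -
    have "col_exps k u = map (\<lambda>i. 2 * k - (part u i + i)) [0..<k]"
      using that part_le[of u] by (auto simp: col_exps_eq words_def)
    then show ?thesis
      by (simp add: multiset.map_comp comp_def atLeast0LessThan)
  qed
  have "fold (\<lambda>e. mix_op q (q ^ e)) (rev (col_exps k v)) = fold (\<lambda>e. mix_op q (q ^ e)) (rev (col_exps k w))"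
    using assms exps by (intro fold_multiset_equiv) (auto simp: fun_eq_iff mix_op_commute)
  then have "(col_op q ^^ k) (word_op q v g) = (col_op q ^^ k) (word_op q w g)"
    using assms by (simp add: col_op_power_word_op words_def)
  moreover have "inj (col_op q ^^ k)"
    using inj_col_op by (rule inj_fn)
  ultimately show ?thesis
    by (simp add: inj_eq)
qed

section \<open>Generating functions of containing words\<close>

definition containing_words :: "line list \<Rightarrow> nat \<Rightarrow> nat \<Rightarrow> line list set" where
  "containing_words w b a = {v \<in> words b a. subseq w v}"

definition containing_gf :: "real \<Rightarrow> line list \<Rightarrow> nat \<Rightarrow> nat \<Rightarrow> real" where
  "containing_gf q w b a = (\<Sum>v\<in>containing_words w b a. q ^ area v)"

lemma finite_containing_words: "finite (containing_words w b a)"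
  using finite_words by (simp add: containing_words_def)

text \<open>Leftmost embedding: a first letter of \<open>v\<close> that agrees with the first letter
  of the pattern can always be matched to it.\<close>

lemma containing_words_Row_iff:
  "v \<in> containing_words (Row # w) b a \<longleftrightarrow>
    (\<exists>u. v = Row # u \<and> b > 0 \<and> u \<in> containing_words w (b - 1) a \<or>
      v = Col # u \<and> a > 0 \<and> u \<in> containing_words (Row # w) b (a - 1))"
proof (cases v)
  case (Cons x u)
  then show ?thesis
    by (cases x) (auto simp: containing_words_def words_def)
qed (auto simp: containing_words_def)

lemma containing_words_Col_iff:
  "v \<in> containing_words (Col # w) b a \<longleftrightarrow>
    (\<exists>u. v = Col # u \<and> a > 0 \<and> u \<in> containing_words w b (a - 1) \<or>
      v = Row # u \<and> b > 0 \<and> u \<in> containing_words (Col # w) (b - 1) a)"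
proof (cases v)
  case (Cons x u)
  then show ?thesis
    by (cases x) (auto simp: containing_words_def words_def)
qed (auto simp: containing_words_def)

lemma count_list_subseq: "subseq (x # w) v \<Longrightarrow> count_list v x \<noteq> 0"
  by (induction v) (auto split: if_splits)

lemma containing_words_Row:
  "containing_words (Row # w) 0 a = {}"
  "containing_words (Row # w) (Suc b) 0 = Cons Row ` containing_words w b 0"
  "containing_words (Row # w) (Suc b) (Suc a) =
     Cons Row ` containing_words w b (Suc a) \<union> Cons Col ` containing_words (Row # w) (Suc b) a"
proof -
  show "containing_words (Row # w) 0 a = {}"
    by (auto simp: containing_words_def words_def dest: count_list_subseq)
next
  have "v \<in> containing_words (Row # w) (Suc b) 0 \<longleftrightarrow> (\<exists>u. v = Row # u \<and> u \<in> containing_words w b 0)" for v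
    unfolding containing_words_Row_iff[of v w "Suc b" 0] by auto
  then show "containing_words (Row # w) (Suc b) 0 = Cons Row ` containing_words w b 0"
    by auto
qed (auto simp: containing_words_Row_iff[of _ w "Suc b" "Suc a"])

lemma containing_words_Col:
  "containing_words (Col # w) b 0 = {}"
  "containing_words (Col # w) 0 (Suc a) = Cons Col ` containing_words w 0 a"
  "containing_words (Col # w) (Suc b) (Suc a) =
     Cons Col ` containing_words w (Suc b) a \<union> Cons Row ` containing_words (Col # w) b (Suc a)"
proof -
  show "containing_words (Col # w) b 0 = {}"
    by (auto simp: containing_words_def words_def dest: count_list_subseq)
next
  have "v \<in> containing_words (Col # w) 0 (Suc a) \<longleftrightarrow> (\<exists>u. v = Col # u \<and> u \<in> containing_words w 0 a)" for v
    unfolding containing_words_Col_iff[of v w 0 "Suc a"] by auto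
  then show "containing_words (Col # w) 0 (Suc a) = Cons Col ` containing_words w 0 a"
    by auto
qed (auto simp: containing_words_Col_iff[of _ w "Suc b" "Suc a"])

lemma sum_Cons_Row:
  "(\<Sum>v\<in>Cons Row ` containing_words w b a. q ^ area v) = (q :: real) ^ a * containing_gf q w b a"
proof -
  have "(\<Sum>v\<in>Cons Row ` containing_words w b a. q ^ area v) =
      (\<Sum>v\<in>containing_words w b a. q ^ area (Row # v))"
    by (simp add: sum.reindex)
  also have "\<dots> = (\<Sum>v\<in>containing_words w b a. q ^ a * q ^ area v)"
    by (rule sum.cong) (simp_all add: containing_words_def words_def power_add)
  finally show ?thesis
    by (simp add: containing_gf_def sum_distrib_left)
qed

lemma sum_Cons_Col:
  "(\<Sum>v\<in>Cons Col ` containing_words w b a. q ^ area v) = containing_gf q w b a"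
  by (simp add: sum.reindex containing_gf_def)

lemma containing_gf_Row: "containing_gf q (Row # w) = row_op q (containing_gf q w)"
proof -
  have "containing_gf q (Row # w) b a = row_op q (containing_gf q w) b a" for b a
  proof (induction q "containing_gf q w" b a rule: row_op.induct)
    case (3 q b a)
    have "containing_gf q (Row # w) (Suc b) (Suc a) =
        (\<Sum>v\<in>Cons Row ` containing_words w b (Suc a) \<union>
          Cons Col ` containing_words (Row # w) (Suc b) a. q ^ area v)"
      by (simp only: containing_gf_def containing_words_Row)
    also have "\<dots> = (\<Sum>v\<in>Cons Row ` containing_words w b (Suc a). q ^ area v) +
        (\<Sum>v\<in>Cons Col ` containing_words (Row # w) (Suc b) a. q ^ area v)"
      by (intro sum.union_disjoint finite_imageI finite_containing_words) blast
    also have "\<dots> = q ^ Suc a * containing_gf q w b (Suc a) + containing_gf q (Row # w) (Suc b) a"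
      by (simp only: sum_Cons_Row sum_Cons_Col)
    finally show ?case
      using 3 by simp
  qed (auto simp: containing_gf_def[of _ "Row # w"] containing_words_Row sum_Cons_Row)
  then show ?thesis
    by (simp add: fun_eq_iff)
qed

lemma containing_gf_Col: "containing_gf q (Col # w) = col_op q (containing_gf q w)"
proof -
  have "containing_gf q (Col # w) b a = col_op q (containing_gf q w) b a" for b a
  proof (induction q "containing_gf q w" b a rule: col_op.induct)
    case (3 q b a)
    have "containing_gf q (Col # w) (Suc b) (Suc a) =
        (\<Sum>v\<in>Cons Col ` containing_words w (Suc b) a \<union>
          Cons Row ` containing_words (Col # w) b (Suc a). q ^ area v)"
      by (simp only: containing_gf_def containing_words_Col)
    also have "\<dots> = (\<Sum>v\<in>Cons Col ` containing_words w (Suc b) a. q ^ area v) +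
        (\<Sum>v\<in>Cons Row ` containing_words (Col # w) b (Suc a). q ^ area v)"
      by (intro sum.union_disjoint finite_imageI finite_containing_words) blast
    also have "\<dots> = containing_gf q w (Suc b) a + q ^ Suc a * containing_gf q (Col # w) b (Suc a)"
      by (simp only: sum_Cons_Row sum_Cons_Col)
    finally show ?case
      using 3 by simp
  qed (auto simp: containing_gf_def[of _ "Col # w"] containing_words_Col sum_Cons_Col)
  then show ?thesis
    by (simp add: fun_eq_iff)
qed

lemma containing_gf_eq: "containing_gf q w = word_op q w (containing_gf q [])"
proof (induction w)
  case (Cons x w)
  then show ?case
    by (cases x) (simp_all add: containing_gf_Row containing_gf_Col)
qed simp

section \<open>Rook numbers\<close>

definition rook_placements :: "(nat \<times> nat) set \<Rightarrow> nat \<Rightarrow> (nat \<times> nat) set set" where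
  "rook_placements B j = {P. P \<subseteq> B \<and> finite P \<and> card P = j \<and> non_attacking P}"

text \<open>The rows from \<open>k\<close> on, in their old positions; the board is built up from
  its shortest rows.\<close>

definition lower_board :: "nat \<Rightarrow> (nat \<Rightarrow> nat) \<Rightarrow> (nat \<times> nat) set" where
  "lower_board k \<mu> = {(i, j). k \<le> i \<and> j < \<mu> i}"

lemma rook_number_0: "rook_number B 0 = 1"
proof -
  have "{P. P \<subseteq> B \<and> finite P \<and> card P = 0 \<and> non_attacking P} = {{}}"
    by (auto simp: non_attacking_def)
  then show ?thesis
    by (simp add: rook_number_def)
qed

lemma finite_lower_board:
  assumes "is_partition \<mu>"
  shows "finite (lower_board k \<mu>)"
  by (rule finite_subset[OF _ finite_board[OF assms]]) (auto simp: lower_board_def board_def)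

lemma non_attacking_insert:
  assumes "non_attacking Q" "\<And>q. q \<in> Q \<Longrightarrow> fst q \<noteq> fst p \<and> snd q \<noteq> snd p"
  shows "non_attacking (insert p Q)"
  unfolding non_attacking_def
proof (intro ballI impI)
  fix a b assume "a \<in> insert p Q" "b \<in> insert p Q" "a \<noteq> b"
  then consider "a = p" "b \<in> Q" | "b = p" "a \<in> Q" | "a \<in> Q" "b \<in> Q" "a \<noteq> b"
    by blast
  then show "fst a \<noteq> fst b \<and> snd a \<noteq> snd b"
  proof cases
    case 1
    then show ?thesis
      using assms(2)[of b] by simp
  next
    case 2
    then show ?thesis
      using assms(2)[of a] by simp
  next
    case 3
    then show ?thesis
      using assms(1) by (simp add: non_attacking_def)
  qed
qed

lemma snd_lower_board:
  assumes "is_partition \<mu>"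
  shows "snd ` lower_board (Suc k) \<mu> \<subseteq> {..<\<mu> k}"
proof -
  have "j < \<mu> k" if "Suc k \<le> i" "j < \<mu> i" for i j
    using antimonoD[of \<mu> k i] that assms by (simp add: is_partition_def)
  then show ?thesis
    by (auto simp: lower_board_def)
qed

text \<open>
  A rook in row \<open>k\<close> may use any of the \<open>\<mu> k\<close> columns except the \<open>j\<close> taken below; these are among
  the first \<open>\<mu> k\<close>. If \<open>\<mu> k < j\<close>, the truncated difference is harmless by \<open>rook_number_eq_0\<close>.
\<close>

lemma rook_number_lower_board:
  assumes "is_partition \<mu>"
  shows "rook_number (lower_board k \<mu>) (Suc j) =
    rook_number (lower_board (Suc k) \<mu>) (Suc j) + (\<mu> k - j) * rook_number (lower_board (Suc k) \<mu>) j"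
proof -
  let ?B = "lower_board k \<mu>" and ?C = "lower_board (Suc k) \<mu>"
  let ?S = "SIGMA P : rook_placements ?C j. {..<\<mu> k} - snd ` P"
  let ?f = "\<lambda>(P, c). insert (k, c) P"
  have finC: "finite ?C"
    using assms by (rule finite_lower_board)
  have fin: "finite (rook_placements ?C i)" for i
    unfolding rook_placements_def by (rule finite_subset[of _ "Pow ?C"]) (auto simp: finC)
  have notin: "(k, c) \<notin> P" if "P \<in> rook_placements ?C i" for P c i
    using that by (auto simp: rook_placements_def lower_board_def)
  have B: "rook_placements ?B (Suc j) = rook_placements ?C (Suc j) \<union> ?f ` ?S"
  proof (intro subset_antisym subsetI)
    fix P assume P: "P \<in> rook_placements ?B (Suc j)"
    show "P \<in> rook_placements ?C (Suc j) \<union> ?f ` ?S"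
    proof (cases "\<exists>c. (k, c) \<in> P")
      case True
      then obtain c where c: "(k, c) \<in> P" by blast
      let ?Q = "P - {(k, c)}"
      have na: "fst p \<noteq> k" "snd p \<noteq> c" if "p \<in> ?Q" for p
        using P c that by (force simp: rook_placements_def non_attacking_def)+
      have "?Q \<subseteq> ?C"
        using P na(1) by (force simp: rook_placements_def lower_board_def)
      then have "?Q \<in> rook_placements ?C j"
        using P c by (auto simp: rook_placements_def non_attacking_def)
      moreover have "c \<in> {..<\<mu> k} - snd ` ?Q"
        using P c na(2) by (auto simp: rook_placements_def lower_board_def)
      ultimately show ?thesis
        using c by (intro UnI2 image_eqI[of _ _ "(?Q, c)"]) auto
    next
      case False
      then have "P \<subseteq> ?C"
        using P by (force simp: rook_placements_def lower_board_def le_eq_less_or_eq[of k])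
      then show ?thesis
        using P by (auto simp: rook_placements_def)
    qed
  next
    fix P assume "P \<in> rook_placements ?C (Suc j) \<union> ?f ` ?S"
    then consider "P \<in> rook_placements ?C (Suc j)"
      | Q c where "P = insert (k, c) Q" "Q \<in> rook_placements ?C j" "c < \<mu> k" "c \<notin> snd ` Q"
      by auto
    then show "P \<in> rook_placements ?B (Suc j)"
    proof cases
      case 1
      then show ?thesis
        by (auto simp: rook_placements_def lower_board_def)
    next
      case 2
      have ne: "fst p \<noteq> k" "snd p \<noteq> c" if "p \<in> Q" for p
        using 2 that by (force simp: rook_placements_def lower_board_def)+
      have "non_attacking Q"
        using 2(2) by (simp add: rook_placements_def)
      then have "non_attacking P"
        unfolding 2(1) by (rule non_attacking_insert) (simp add: ne)
      moreover have "Q \<subseteq> ?B"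
        using 2(2) by (auto simp: rook_placements_def lower_board_def)
      then have "P \<subseteq> ?B"
        using 2(1,3) by (simp add: lower_board_def)
      moreover have "finite Q" "card Q = j"
        using 2(2) by (auto simp: rook_placements_def)
      then have "finite P" "card P = Suc j"
        using 2(1) notin[OF 2(2), of c] by simp_all
      ultimately show ?thesis
        by (simp add: rook_placements_def)
    qed
  qed
  have inj: "inj_on ?f ?S"
  proof (rule inj_onI, clarsimp)
    fix P c Q d
    assume PQ: "P \<in> rook_placements ?C j" "Q \<in> rook_placements ?C j"
      and eq: "insert (k, c) P = insert (k, d) Q"
    have "(k, c) \<in> insert (k, d) Q"
      using eq by blast
    then have "c = d"
      using notin[OF PQ(2)] by simp
    then show "P = Q \<and> c = d"
      using eq insert_ident[of "(k, c)" P Q] notin[OF PQ(1)] notin[OF PQ(2)] by simp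
  qed
  have "card ({..<\<mu> k} - snd ` P) = \<mu> k - j" if "P \<in> rook_placements ?C j" for P
  proof -
    have "inj_on snd P"
      using that by (auto simp: rook_placements_def non_attacking_def inj_on_def)
    then have "card (snd ` P) = j"
      using that by (simp add: rook_placements_def card_image)
    moreover have "snd ` P \<subseteq> {..<\<mu> k}"
      using that snd_lower_board[OF assms, of k] by (auto simp: rook_placements_def)
    ultimately show ?thesis
      using that by (simp add: card_Diff_subset rook_placements_def)
  qed
  then have "card ?S = (\<mu> k - j) * card (rook_placements ?C j)"
    using fin by (subst card_SigmaI) auto
  moreover have "card (rook_placements ?B (Suc j)) = card (rook_placements ?C (Suc j)) + card ?S"
    unfolding B card_image[OF inj, symmetric] using fin notin
    by (intro card_Un_disjoint) auto
  ultimately show ?thesis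
    by (simp add: rook_number_def rook_placements_def)
qed

text \<open>The rooks need distinct columns, all among the first \<open>\<mu> k\<close>.\<close>

lemma rook_number_eq_0:
  assumes "is_partition \<mu>" "\<mu> k < j"
  shows "rook_number (lower_board (Suc k) \<mu>) j = 0"
proof -
  have "card P \<noteq> j" if "P \<subseteq> lower_board (Suc k) \<mu>" "non_attacking P" for P
  proof -
    have "inj_on snd P"
      using that(2) by (auto simp: non_attacking_def inj_on_def)
    moreover have "snd ` P \<subseteq> {..<\<mu> k}"
      using that(1) snd_lower_board[OF assms(1), of k] by blast
    ultimately have "card P \<le> \<mu> k"
      by (metis card_image card_lessThan card_mono finite_lessThan)
    then show ?thesis
      using assms(2) by simp
  qed
  then have "{P. P \<subseteq> lower_board (Suc k) \<mu> \<and> finite P \<and> card P = j \<and> non_attacking P} = {}"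
    by blast
  then show ?thesis
    by (simp only: rook_number_def card.empty)
qed

lemma rook_number_eq_0_rows:
  assumes "\<And>i. K \<le> i \<Longrightarrow> \<mu> i = 0" "K - k < j"
  shows "rook_number (lower_board k \<mu>) j = 0"
proof -
  have "card P \<noteq> j" if "P \<subseteq> lower_board k \<mu>" "non_attacking P" for P
  proof -
    have "inj_on fst P"
      using that(2) by (auto simp: non_attacking_def inj_on_def)
    moreover have "i < K" if "j < \<mu> i" for i j
      using assms(1)[of i] that by (cases "K \<le> i") auto
    then have "fst ` P \<subseteq> {k..<K}"
      using that(1) by (force simp: lower_board_def)
    ultimately have "card P \<le> K - k"
      by (metis card_image card_atLeastLessThan card_mono finite_atLeastLessThan)
    then show ?thesis
      using assms(2) by simp
  qed
  then have "{P. P \<subseteq> lower_board k \<mu> \<and> finite P \<and> card P = j \<and> non_attacking P} = {}"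
    by blast
  then show ?thesis
    by (simp only: rook_number_def card.empty)
qed

text \<open>Adding row \<open>k\<close> above \<open>m\<close> rows multiplies the term with
  \<open>j\<close> lower rooks by \<open>(x - (m - j)) + (\<mu> k - j) = x + \<mu> k - m\<close>.
  This does not depend on \<open>j\<close>, so it factors out of the sum.\<close>

lemma rook_polynomial_factorization:
  fixes x :: real
  assumes \<mu>: "is_partition \<mu>" and K: "\<And>i. K \<le> i \<Longrightarrow> \<mu> i = 0" and "m \<le> K"
  shows "(\<Sum>j\<le>m. rook_number (lower_board (K - m) \<mu>) j * (\<Prod>l<m - j. x - real l)) =
    (\<Prod>i\<in>{K - m..<K}. x + \<mu> i + i + 1 - K)"
  using assms(3)
proof (induction m)
  case 0
  have "lower_board K \<mu> = {}"
    using K by (auto simp: lower_board_def)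
  then show ?case
    by (simp add: rook_number_0)
next
  case (Suc m)
  define k where "k = K - Suc m"
  have k: "K - m = Suc k" "k + Suc m = K"
    using Suc.prems by (auto simp: k_def)
  define r where "r = rook_number (lower_board (Suc k) \<mu>)"
  let ?F = "\<lambda>j. \<Prod>l<j. x - real l"
  \<comment> \<open>Only \<open>m\<close> rows below row \<open>k\<close> can be nonempty; this
    removes the top term after the index shift.\<close>
  have zero: "r (Suc m) = 0"
    unfolding r_def using K k by (intro rook_number_eq_0_rows) auto
  have "(\<Sum>j\<le>Suc m. rook_number (lower_board k \<mu>) j * ?F (Suc m - j)) =
    ?F (Suc m) + (\<Sum>j\<le>m. rook_number (lower_board k \<mu>) (Suc j) * ?F (m - j))"
    by (subst sum.atMost_Suc_shift) (simp add: rook_number_0)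
  also have "(\<Sum>j\<le>m. rook_number (lower_board k \<mu>) (Suc j) * ?F (m - j)) =
     (\<Sum>j\<le>m. r (Suc j) * ?F (m - j)) + (\<Sum>j\<le>m. (real (\<mu> k) - real j) * r j * ?F (m - j))"
    unfolding sum.distrib[symmetric]
  proof (rule sum.cong)
    fix j
    have "real (\<mu> k - j) * r j = (real (\<mu> k) - real j) * r j"
      using rook_number_eq_0[OF \<mu>, of k j] by (cases "j \<le> \<mu> k") (auto simp: r_def of_nat_diff)
    then have "real (rook_number (lower_board k \<mu>) (Suc j)) = r (Suc j) + (real (\<mu> k) - real j) * r j"
      unfolding rook_number_lower_board[OF \<mu>] r_def[symmetric] by simp
    then show "rook_number (lower_board k \<mu>) (Suc j) * ?F (m - j) =
      r (Suc j) * ?F (m - j) + (real (\<mu> k) - real j) * r j * ?F (m - j)"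
      by (simp add: distrib_right)
  qed simp
  also have "?F (Suc m) + ((\<Sum>j\<le>m. r (Suc j) * ?F (m - j)) + (\<Sum>j\<le>m. (real (\<mu> k) - real j) * r j * ?F (m - j)))
    = (\<Sum>j\<le>Suc m. r j * ?F (Suc m - j)) + (\<Sum>j\<le>m. (real (\<mu> k) - real j) * r j * ?F (m - j))"
    by (subst sum.atMost_Suc_shift) (simp add: rook_number_0 r_def)
  also have "(\<Sum>j\<le>Suc m. r j * ?F (Suc m - j)) = (\<Sum>j\<le>m. r j * ((x - (m - j)) * ?F (m - j)))"
    using zero by (simp, intro sum.cong refl) (simp add: Suc_diff_le of_nat_diff)
  also have "\<dots> + (\<Sum>j\<le>m. (real (\<mu> k) - real j) * r j * ?F (m - j)) =
    (x + \<mu> k - m) * (\<Sum>j\<le>m. r j * ?F (m - j))"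
    unfolding sum.distrib[symmetric] sum_distrib_left
    by (intro sum.cong refl) (simp add: algebra_simps of_nat_diff)
  also have "(\<Sum>j\<le>m. r j * ?F (m - j)) = (\<Prod>i\<in>{Suc k..<K}. x + \<mu> i + i + 1 - K)"
    using Suc k by (simp add: r_def)
  also have "(x + \<mu> k - m) * \<dots> = (\<Prod>i\<in>{k..<K}. x + \<mu> i + i + 1 - K)"
  proof -
    have "real K = k + Suc m" using k by linarith
    then show ?thesis
      using k by (simp add: prod.atLeast_Suc_lessThan[of k K])
  qed
  finally show ?case
    by (simp add: k_def)
qed

text \<open>In characteristic 0, equal polynomial functions come from equal polynomials, and the
  roots of the product, with multiplicity, are the negatives of the values of
  \<open>f\<close>.\<close>

lemma image_mset_eq_of_prod_eq:
  fixes f g :: "'a \<Rightarrow> 'b :: {idom, ring_char_0}"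
  assumes "finite A" "\<And>x. (\<Prod>i\<in>A. x + f i) = (\<Prod>i\<in>A. x + g i)"
  shows "image_mset f (mset_set A) = image_mset g (mset_set A)"
proof -
  have roots: "image_mset h (mset_set A) = image_mset uminus (proots (\<Prod>i\<in>A. [:h i, 1:]))" for h :: "'a \<Rightarrow> 'b"
    using assms(1) by (induction A rule: finite_induct) (simp_all add: proots_mult del: mult_pCons_left)
  have "(\<Prod>i\<in>A. [:f i, 1:]) = (\<Prod>i\<in>A. [:g i, 1:])"
    using assms(2) by (simp add: poly_eq_poly_eq_iff[symmetric] fun_eq_iff poly_prod add.commute)
  then show ?thesis
    using roots by metis
qed

lemma rook_equivalent_imp_mset_eq:
  assumes "is_partition \<mu>" "is_partition \<tau>" "rook_equivalent \<mu> \<tau>"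
    and "\<And>i. K \<le> i \<Longrightarrow> \<mu> i = 0" "\<And>i. K \<le> i \<Longrightarrow> \<tau> i = 0"
  shows "image_mset (\<lambda>i. \<mu> i + i) (mset_set {..<K}) = image_mset (\<lambda>i. \<tau> i + i) (mset_set {..<K})"
proof -
  \<comment> \<open>Shifting the variable by \<open>K - 1\<close> turns the factors into
    \<open>x + (\<nu> i + i)\<close>, while the left side depends on \<open>\<nu>\<close> only
    through its rook numbers.\<close>
  have fac: "(\<Sum>j\<le>K. rook_number (board \<nu>) j * (\<Prod>l<K - j. x + real K - 1 - real l)) = (\<Prod>i<K. x + real (\<nu> i + i))"
    if "is_partition \<nu>" "\<And>i. K \<le> i \<Longrightarrow> \<nu> i = 0" for \<nu> and x :: real
    using rook_polynomial_factorization[OF that(1), of K K "x + real K - 1", OF that(2)]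
    by (simp add: lower_board_def board_def atLeast0LessThan algebra_simps)
  have "image_mset (\<lambda>i. real (\<mu> i + i)) (mset_set {..<K}) = image_mset (\<lambda>i. real (\<tau> i + i)) (mset_set {..<K})"
    using assms fac[OF assms(1,4), symmetric] fac[OF assms(2,5), symmetric]
    by (intro image_mset_eq_of_prod_eq) (simp_all add: rook_equivalent_def)
  then have "image_mset real (image_mset (\<lambda>i. \<mu> i + i) (mset_set {..<K})) =
      image_mset real (image_mset (\<lambda>i. \<tau> i + i) (mset_set {..<K}))"
    by (simp add: multiset.map_comp comp_def)
  then show ?thesis
    using injD[OF multiset.inj_map[OF inj_of_nat[where 'a = real]]] by blast
qed

section \<open>Wilf equivalence\<close>

lemma le_weight:
  assumes "is_partition \<alpha>"
  shows "\<alpha> i \<le> weight \<alpha>"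
  using assms member_le_sum[of i "{i. \<alpha> i > 0}" \<alpha>]
  by (cases "\<alpha> i > 0") (auto simp: is_partition_def weight_def)

lemma eq_0_of_weight_le:
  assumes "is_partition \<alpha>" "weight \<alpha> \<le> i"
  shows "\<alpha> i = 0"
proof (rule ccontr)
  assume "\<alpha> i \<noteq> 0"
  then have pos: "\<alpha> k > 0" if "k \<le> i" for k
    using assms(1) antimonoD[of \<alpha> k i] that by (simp add: is_partition_def)
  then have "(\<Sum>k\<le>i. 1) \<le> (\<Sum>k\<le>i. \<alpha> k)"
    by (intro sum_mono) (simp add: Suc_leI)
  also have "\<dots> \<le> weight \<alpha>"
    unfolding weight_def using assms(1) pos by (intro sum_mono2) (auto simp: is_partition_def)
  finally show False
    using assms(2) by simp
qed

text \<open>Containment ignores the empty rows and columns of \<open>w\<close>, whereas a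
  subsequence has to match them. As \<open>area v\<close> bounds the numbers of nonempty lines of
  \<open>v\<close>, at least \<open>k\<close> empty rows and \<open>k\<close> empty columns are
  available.\<close>

lemma contains_part_iff_subseq:
  assumes w: "w \<in> words k k" and v: "v \<in> words (area v + k) (area v + k)"
  shows "contains (part v) (part w) \<longleftrightarrow> subseq w v"
proof
  assume "subseq w v"
  then show "contains (part v) (part w)"
    using subseq_imp_embeds embeds_imp_contains by blast
next
  assume "contains (part v) (part w)"
  then obtain r c where emb: "embeds r c (part w) (part v)"
    using contains_iff_embeds[OF is_partition_part] by blast
  define n where "n = area v"
  have le: "part v i \<le> n" for i
    using le_weight[OF is_partition_part] by (simp add: n_def weight_part)
  have zero: "part v i = 0" if "n \<le> i" for i
    using eq_0_of_weight_le[OF is_partition_part] that by (simp add: n_def weight_part)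
  have anti: "part w j \<le> part w i" if "i \<le> j" for i j
    using antimonoD[OF antimono_part that] .
  have mono: "r i < r j" "c i < c j" if "i < j" for i j
    using emb that by (auto simp: embeds_def strict_mono_def)
  have iff: "c j < part v (r i) \<longleftrightarrow> j < part w i" for i j
    using emb by (simp add: embeds_def)
  have r_less: "r i < n" if "part w i > 0" for i
    using iff[of 0 i] that zero[of "r i"] by (cases "n \<le> r i") auto
  have c_less: "c j < n" if "j < part w 0" for j
    using iff[of j 0] that le[of "r 0"] by simp
  \<comment> \<open>Empty lines of \<open>w\<close> are sent to empty lines of \<open>v\<close>,
    beyond the images of the nonempty ones.\<close>
  let ?r = "\<lambda>i. if part w i > 0 then r i else n + i"
  let ?c = "\<lambda>j. if j < part w 0 then c j else n + j"
  show "subseq w v"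
  proof (rule subseq_if_finite_embedding)
    show "strict_mono ?r"
    proof (rule strict_monoI)
      fix i j :: nat assume "i < j"
      then show "?r i < ?r j"
        using mono(1)[of i j] r_less[of i] anti[of i j] by auto
    qed
    show "strict_mono ?c"
    proof (rule strict_monoI)
      fix i j :: nat assume "i < j"
      then show "?c i < ?c j"
        using mono(2)[of i j] c_less[of i] by auto
    qed
    show "?r i < count_list v Row" if "i < count_list w Row" for i
      using that w v r_less[of i] by (auto simp: words_def n_def)
    show "?c j < count_list v Col" if "j < count_list w Col" for j
      using that w v c_less[of j] by (auto simp: words_def n_def)
    show "?c j < part v (?r i) \<longleftrightarrow> j < part w i" for i j
      using iff[of j i] le[of "r i"] zero[of "n + i"] anti[of 0 i] by auto
  qed
qed

lemma card_partitions_containing_part: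
  assumes "w \<in> words k k"
  shows "card (partitions_containing n (part w)) =
    card {v \<in> containing_words w (n + k) (n + k). area v = n}" (is "_ = card ?V")
proof -
  have "partitions_containing n (part w) = part ` ?V"
  proof (intro subset_antisym subsetI)
    fix \<alpha> assume "\<alpha> \<in> partitions_containing n (part w)"
    then have \<alpha>: "is_partition \<alpha>" "weight \<alpha> = n" "contains \<alpha> (part w)"
      by (auto simp: partitions_containing_def)
    obtain v where v: "v \<in> words (n + k) (n + k)" "part v = \<alpha>"
      using ex_word[of \<alpha> "n + k" "n + k"] \<alpha> le_weight[OF \<alpha>(1), of 0] eq_0_of_weight_le[OF \<alpha>(1)]
      by (auto simp: is_partition_def)
    have "area v = n"
      using v \<alpha> weight_part by metis
    then have "v \<in> ?V"
      using v \<alpha> assms contains_part_iff_subseq[of w k v] by (simp add: containing_words_def)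
    then show "\<alpha> \<in> part ` ?V"
      using v by blast
  next
    fix \<alpha> assume "\<alpha> \<in> part ` ?V"
    then show "\<alpha> \<in> partitions_containing n (part w)"
      using assms contains_part_iff_subseq[of w k]
      by (auto simp: partitions_containing_def containing_words_def is_partition_part weight_part)
  qed
  moreover have "inj_on part ?V"
    by (rule inj_on_subset[OF inj_on_part[of "n + k" "n + k"]]) (auto simp: containing_words_def)
  ultimately show ?thesis
    by (simp add: card_image)
qed

lemma card_area_eq_of_containing_gf_eq:
  assumes "\<And>q. q \<noteq> 0 \<Longrightarrow> containing_gf q v b a = containing_gf q w b a"
  shows "card {u \<in> containing_words v b a. area u = n} = card {u \<in> containing_words w b a. area u = n}"
proof -
  define p where "p = (\<lambda>w. \<Sum>u\<in>containing_words w b a. monom (1 :: real) (area u))"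
  have poly_p: "poly (p w) q = containing_gf q w b a" for w q
    by (simp add: p_def containing_gf_def poly_sum poly_monom)
  have "coeff (p w) n = (\<Sum>u\<in>containing_words w b a. if area u = n then 1 else 0)" for w
    by (simp add: p_def coeff_sum)
  also have "\<dots>w = card {u \<in> containing_words w b a. area u = n}" for w
    by (simp add: sum.If_cases finite_containing_words Int_def)
  finally have coeff_p: "coeff (p w) n = card {u \<in> containing_words w b a. area u = n}" for w .
  \<comment> \<open>Multiplying by the variable makes the two sides agree at \<open>q = 0\<close>
    too, where the hypothesis says nothing.\<close>
  have "poly (pCons 0 (p v)) q = poly (pCons 0 (p w)) q" for q
    using assms[of q] by (cases "q = 0") (simp_all add: poly_p)
  then have "p v = p w"
    by (metis pCons_eq_iff poly_eq_poly_eq_iff ext)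
  then show ?thesis
    using coeff_p of_nat_eq_iff by metis
qed

theorem theorem3p2:
  fixes \<mu> \<tau> :: "nat \<Rightarrow> nat"
  assumes "is_partition \<mu>" and "is_partition \<tau>"
    and "rook_equivalent \<mu> \<tau>"
  shows "wilf_equivalent \<mu> \<tau>"
proof -
  \<comment> \<open>Both boards fit into one \<open>k\<close> by \<open>k\<close> square, since the
    weight bounds the number of rows and the largest part.\<close>
  define k where "k = max (weight \<mu>) (weight \<tau>)"
  have zero: "\<mu> i = 0" "\<tau> i = 0" if "k \<le> i" for i
    using that eq_0_of_weight_le assms(1,2) by (auto simp: k_def)
  have le: "\<mu> 0 \<le> k" "\<tau> 0 \<le> k"
    using le_weight[OF assms(1), of 0] le_weight[OF assms(2), of 0] by (auto simp: k_def)
  obtain v where v: "v \<in> words k k" "part v = \<mu>"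
    using ex_word[of \<mu> k k] assms(1) zero le by (auto simp: is_partition_def)
  obtain w where w: "w \<in> words k k" "part w = \<tau>"
    using ex_word[of \<tau> k k] assms(2) zero le by (auto simp: is_partition_def)
  have "containing_gf q v = containing_gf q w" if "q \<noteq> 0" for q
    unfolding containing_gf_eq[of q v] containing_gf_eq[of q w]
    using word_op_cong[OF that v(1) w(1)] rook_equivalent_imp_mset_eq[OF assms zero] v w by simp
  then have "card (partitions_containing n \<mu>) = card (partitions_containing n \<tau>)" for n
    using card_partitions_containing_part[OF v(1), of n] card_partitions_containing_part[OF w(1), of n]
      card_area_eq_of_containing_gf_eq[of v "n + k" "n + k" w n] v w by simp
  then show ?thesis
    by (simp add: wilf_equivalent_def)
qed

end
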